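(* Let $I\subset\mathbb R$ be an interval with non-empty interior. The graphs of two $C^2$ functions $f_1:I\to\mathbb R$ and $f_2:I\to\mathbb R$ have the same tangent lines, i.e. $\mathcal T(f_1)=\mathcal T(f_2)$, if, and only if, $f_1=f_2$.
   Context: For a differentiable function $f:I\to\mathbb R$ on an interval $I$ with non-empty interior, $\mathcal T(f)$ denotes the set of affine lines in $\mathbb R^2$ that are tangent to the graph of $f$, regarded as a bare subset of the set of affine lines (without recording the points of tangency). Identifying the line $y=mx-q$ with the pair $(m,q)\in\mathbb R^2$, one has $\mathcal T(f)=\{(f'(x),xf'(x)-f(x))\mid x\in I\}$. The interval $I$ is arbitrary (open, closed, half-open, bounded or not). *)

theory Defs
  imports "HOL-Analysis.Analysis"
begin

text \<open>
  A function \<open>I \<rightarrow> \<real>\<close> is a total function whose values outside \<open>I\<close> are irrelevant;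
  derivatives are taken within \<open>I\<close>, so they are one-sided at an endpoint belonging to \<open>I\<close>.
\<close>

definition C2_on :: "real set \<Rightarrow> (real \<Rightarrow> real) \<Rightarrow> bool" where
  "C2_on I f \<longleftrightarrow>
     (\<exists>f' f''. (\<forall>x\<in>I. (f has_real_derivative f' x) (at x within I)) \<and>
               (\<forall>x\<in>I. (f' has_real_derivative f'' x) (at x within I)) \<and>
               continuous_on I f'')"

definition affine_line :: "real \<Rightarrow> real \<Rightarrow> (real \<times> real) set" where
  "affine_line m q = {(x, y). y = m * x - q}"

text \<open>
  The value \<open>q = x * m - f x\<close> makes the line of slope \<open>m\<close> pass through \<open>(x, f x)\<close>.
  When \<open>I\<close> is an interval with non-empty interior, \<open>m\<close> is uniquely determined by \<open>x\<close>.
\<close>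

definition tangent_lines :: "real set \<Rightarrow> (real \<Rightarrow> real) \<Rightarrow> (real \<times> real) set set" where
  "tangent_lines I f =
     {affine_line m (x * m - f x) | x m. x \<in> I \<and> (f has_real_derivative m) (at x within I)}"

text \<open>Lines in the plane of the form \<open>y = m x - q\<close> correspond bijectively to pairs \<open>(m, q)\<close>.\<close>

lemma affine_line_eq_iff: "affine_line m q = affine_line m' q' \<longleftrightarrow> m = m' \<and> q = q'"
proof
  assume eq: "affine_line m q = affine_line m' q'"
  have "(0, - q) \<in> affine_line m' q'" "(1, m - q) \<in> affine_line m' q'"
    by (simp_all flip: eq, simp_all add: affine_line_def)
  then show "m = m' \<and> q = q'" by (simp add: affine_line_def)
qed simp

end

theory Submission
  imports Defs
begin

text \<open>
  Only the implication from equality of the sets of tangent lines to equality of the functions needs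
  an argument. Write \<open>u = f'\<close>, \<open>v = g'\<close>. In the plane of pairs \<open>(m, q)\<close> the tangent lines of \<open>f\<close> are
  traced by \<open>x \<mapsto> (u x, x * u x - f x)\<close>, whose velocity is \<open>u' x\<close> times \<open>(1, x)\<close>. Where \<open>u'\<close> does not
  vanish, the traced curve is therefore locally a graph \<open>q = h m\<close>, and its slope over \<open>u x\<close> is
  the abscissa \<open>x\<close>: the curve remembers the points of tangency.

  Let \<open>u'\<close> have no zero on an open interval \<open>J\<close>. Every tangent line of \<open>f\<close> at a point of \<open>J\<close> is
  a tangent line of \<open>g\<close> at some \<open>y\<close>; suppose that \<open>y\<close> never equals the abscissa \<open>x\<close> of that point. The
  values of \<open>v\<close> at the \<open>y\<close> with \<open>v' y = 0\<close> form a null set (\<open>real_Sard\<close>). At the \<open>y\<close> with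
  \<open>v' y \<noteq> 0\<close> the two dual curves cross with different slopes \<open>x\<close> and \<open>y\<close>, so these \<open>y\<close> are isolated, hence
  countable in number. Together these values fill the non-empty open set \<open>u ` J\<close>, which is absurd. So
  \<open>f\<close> and \<open>g\<close> share a tangent line at one and the same abscissa in each such \<open>J\<close>
  (\<open>common_tangent_at_same_abscissa\<close>), and by density and continuity \<open>f = g\<close> and \<open>u = v\<close> wherever
  \<open>u' \<noteq> 0\<close> (\<open>same_tangent_where_curved\<close>); by symmetry also wherever \<open>v' \<noteq> 0\<close>.

  It follows that \<open>u' = v'\<close> on the whole interval, so \<open>u - v\<close> is constant. If \<open>u'\<close> has a non-zero value,
  then \<open>u - v\<close> and \<open>f - g\<close> vanish at that point, hence everywhere. Otherwise both functions are affine,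
  and each has a single tangent line, which is its graph.
\<close>

section \<open>Images of critical sets and countability of discrete sets\<close>

text \<open>Sard's theorem for maps of \<open>real^1\<close> to itself, transported to \<open>real\<close> through \<open>real^1\<close>.\<close>
lemma real_Sard:
  fixes f :: "real \<Rightarrow> real"
  assumes "\<And>x. x \<in> S \<Longrightarrow> (f has_real_derivative 0) (at x within S)"
  shows "negligible (f ` S)"
proof -
  let ?v = "vec :: real \<Rightarrow> real^1" and ?d = "\<lambda>x::real^1. x $ 1"
  let ?F = "?v \<circ> f \<circ> ?d"
  have bl_v: "bounded_linear ?v"
    by (simp add: linear_linear linear_iff vec_add vec_cmul scalar_mult_eq_scaleR)
  have bl_d: "bounded_linear ?d"
    by (rule bounded_linear_vec_nth)
  have der: "(?F has_derivative (\<lambda>_. 0)) (at x within ?v ` S)" if "x \<in> ?v ` S" for x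
  proof -
    from that have x: "?d x \<in> S" by auto
    have "?d ` (?v ` S) = S" by (auto simp: image_image)
    moreover have "(f has_derivative (\<lambda>_. 0)) (at (?d x) within S)"
      using assms[OF x] by (simp add: has_field_derivative_def lambda_zero)
    ultimately have "(f \<circ> ?d has_derivative (\<lambda>_. 0) \<circ> ?d) (at x within ?v ` S)"
      by (intro diff_chain_within) (auto intro: bounded_linear_imp_has_derivative bl_d)
    from bounded_linear.has_derivative[OF bl_v this]
    show ?thesis by (simp add: o_def linear_0[OF bounded_linear.linear[OF bl_v]])
  qed
  have "rank (matrix ((\<lambda>_. 0) :: real^1 \<Rightarrow> real^1)) = 0"
    by (simp add: rank_eq_0 matrix_def vec_eq_iff)
  then have "negligible (?F ` ?v ` S)"
    using der by (intro baby_Sard[of "?v ` S" ?F "\<lambda>_ _. 0"]) auto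
  then have "negligible (?d ` ?F ` ?v ` S)"
    by (rule negligible_differentiable_image_negligible[rotated])
       (auto intro: linear_imp_differentiable_on bounded_linear.linear bl_d)
  then show ?thesis by (simp add: image_image)
qed

lemma discrete_imp_countable:
  fixes D :: "'a::second_countable_topology set"
  assumes "discrete D"
  shows "countable D"
proof -
  obtain B :: "'a set set" where B: "countable B" "topological_basis B"
    using ex_countable_basis by blast
  have "\<exists>b\<in>B. b \<inter> D = {x}" if "x \<in> D" for x
  proof -
    have "x isolated_in D" using assms that by (rule discreteD)
    then obtain T where "open T" "T \<inter> D = {x}"
      by (rule isolated_inE)
    then obtain b where "b \<in> B" "x \<in> b" "b \<subseteq> T"
      using topological_basisE[OF B(2)] by blast
    with \<open>T \<inter> D = {x}\<close> show ?thesis by blast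
  qed
  then obtain h where h: "\<And>x. x \<in> D \<Longrightarrow> h x \<in> B \<and> h x \<inter> D = {x}" by metis
  then have "inj_on h D" by (metis inj_onI singleton_inject)
  moreover have "h ` D \<subseteq> B" using h by blast
  ultimately show ?thesis
    using B(1) countable_subset countable_image_inj_on by metis
qed

text \<open>
  At a limit point of \<open>S\<close> the derivative within \<open>S\<close> is unique, so that of a function constant on \<open>S\<close>
  is zero; at an isolated point every number is a derivative.
\<close>
lemma isolated_in_nonzero_derivative:
  fixes f :: "real \<Rightarrow> real"
  assumes "(f has_real_derivative d) (at x within S)" "d \<noteq> 0" "x \<in> S"
    and "\<And>y. y \<in> S \<Longrightarrow> f y = c"
  shows "x isolated_in S"
proof (rule ccontr)
  assume "\<not> x isolated_in S"
  with assms(3) have "at x within S \<noteq> bot"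
    by (simp add: isolated_in_islimpt_iff trivial_limit_within)
  moreover have "(f has_real_derivative 0) (at x within S)"
    by (rule has_field_derivative_transform_within[of "\<lambda>_. c" _ _ _ 1]) (use assms(3,4) in auto)
  ultimately show False
    using has_field_derivative_unique assms(1,2) by metis
qed

section \<open>A tangent line common to both graphs at the same abscissa\<close>

lemma inj_on_if_derivative_nonzero:
  fixes u u' :: "real \<Rightarrow> real"
  assumes "\<And>x. a < x \<Longrightarrow> x < b \<Longrightarrow> (u has_real_derivative u' x) (at x)"
    and "\<And>x. a < x \<Longrightarrow> x < b \<Longrightarrow> u' x \<noteq> 0"
  shows "inj_on u {a<..<b}"
proof (rule linorder_inj_onI)
  fix x y assume xy: "x < y" "x \<in> {a<..<b}" "y \<in> {a<..<b}"
  show "u x \<noteq> u y"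
  proof
    assume "u x = u y"
    moreover have "continuous_on {x..y} u"
      using xy DERIV_isCont[OF assms(1)] by (intro continuous_at_imp_continuous_on) auto
    moreover have "u differentiable (at z)" if "x < z" "z < y" for z
      using xy that assms(1)[of z] by (auto simp: real_differentiable_def)
    ultimately obtain z where "x < z" "z < y" "(u has_real_derivative 0) (at z)"
      using Rolle[OF xy(1)] by metis
    then show False
      using assms[of z] xy DERIV_unique by fastforce
  qed
qed auto

text \<open>
  The hypothesis \<open>cover\<close> says that each tangent line of \<open>f\<close> at a point of \<open>{a<..<b}\<close> is tangent to \<open>g\<close>
  somewhere. The set \<open>I\<close> is arbitrary; only the derivatives of \<open>g\<close> within it matter.
\<close>
lemma common_tangent_at_same_abscissa:
  fixes f g u u' v v' :: "real \<Rightarrow> real"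
  assumes ab: "a < b"
    and f: "\<And>x. a < x \<Longrightarrow> x < b \<Longrightarrow> (f has_real_derivative u x) (at x)"
    and u: "\<And>x. a < x \<Longrightarrow> x < b \<Longrightarrow> (u has_real_derivative u' x) (at x)"
    and u': "\<And>x. a < x \<Longrightarrow> x < b \<Longrightarrow> u' x \<noteq> 0"
    and g: "\<And>y. y \<in> I \<Longrightarrow> (g has_real_derivative v y) (at y within I)"
    and v: "\<And>y. y \<in> I \<Longrightarrow> (v has_real_derivative v' y) (at y within I)"
    and cover: "\<And>x. a < x \<Longrightarrow> x < b \<Longrightarrow> \<exists>y\<in>I. v y = u x \<and> y * v y - g y = x * u x - f x"
  shows "\<exists>x. a < x \<and> x < b \<and> f x = g x \<and> u x = v x"
proof (rule ccontr)
  assume neg: "\<not> ?thesis"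
  let ?J = "{a<..<b}"
  have inj: "inj_on u ?J"
    by (rule inj_on_if_derivative_nonzero) (use u u' in auto)
  have cont: "continuous_on ?J u"
    using DERIV_isCont[OF u] by (intro continuous_at_imp_continuous_on) auto
  have "open (u ` ?J)"
    by (rule injective_into_1d_imp_open_map_UNIV[OF _ cont inj]) auto
  define X where "X = inv_into ?J u"
  have X: "X (u x) = x" if "x \<in> ?J" for x
    unfolding X_def using inj that by simp
  \<comment> \<open>The dual curve of \<open>f\<close> as a graph \<open>q = h m\<close>; its slope over \<open>m = u x\<close> is \<open>x\<close>.\<close>
  define h where "h m = X m * m - f (X m)" for m
  have dX: "(X has_real_derivative 1 / u' x) (at (u x))" if "x \<in> ?J" for x
    unfolding has_field_derivative_def
    by (rule has_derivative_inverse_on[of ?J u "\<lambda>x. (*) (u' x)"])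
       (use that u u' X in \<open>auto simp: has_field_derivative_def fun_eq_iff\<close>)
  have dh: "(h has_real_derivative x) (at (u x))" if x: "x \<in> ?J" for x
  proof -
    have "(f has_real_derivative u x) (at (X (u x)))" using f x X by auto
    from DERIV_chain2[OF this dX[OF x]]
    show ?thesis unfolding h_def
      by (auto intro!: derivative_eq_intros dX[OF x] simp: X[OF x])
  qed
  \<comment> \<open>The abscissae at which \<open>g\<close> has a tangent line of \<open>f\<close>, split by vanishing of \<open>v'\<close>.\<close>
  define Y where "Y = {y \<in> I. \<exists>x\<in>?J. v y = u x \<and> y * v y - g y = x * u x - f x}"
  define C where "C = {y \<in> Y. v' y = 0}"
  define D where "D = {y \<in> Y. v' y \<noteq> 0}"
  have "negligible (v ` C)"
  proof (rule real_Sard)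
    fix y assume "y \<in> C"
    then have "y \<in> I" "v' y = 0" "C \<subseteq> I" by (auto simp: C_def Y_def)
    then show "(v has_real_derivative 0) (at y within C)"
      using v[of y] DERIV_subset by metis
  qed
  moreover have "discrete D"
  proof (rule discreteI)
    fix y assume y: "y \<in> D"
    then obtain x where x: "x \<in> ?J" "v y = u x" "y * v y - g y = x * u x - f x"
      unfolding D_def Y_def by blast
    have "x \<noteq> y"
    proof
      assume "x = y"
      have "a < x" "x < b" using x(1) by simp_all
      moreover have "u x = v x" using x(2) unfolding \<open>x = y\<close> by (rule sym)
      moreover have "f x = g x" using x(2,3) unfolding \<open>x = y\<close> by simp
      ultimately show False using neg by blast
    qed
    \<comment> \<open>The difference of ordinates of the two dual curves vanishes on \<open>D\<close>, but its derivative at \<open>y\<close>,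
      the difference of slopes times \<open>v' y\<close>, does not.\<close>
    have "D \<subseteq> I" by (auto simp: D_def Y_def)
    with y have dg: "(g has_real_derivative v y) (at y within D)"
      and dv: "(v has_real_derivative v' y) (at y within D)"
      using g v DERIV_subset by blast+
    have "((\<lambda>y. h (v y)) has_real_derivative x * v' y) (at y within D)"
      by (rule DERIV_chain2[OF _ dv]) (unfold x(2), rule dh[OF x(1)])
    then have "((\<lambda>y. h (v y) - (y * v y - g y)) has_real_derivative (x - y) * v' y) (at y within D)"
      by (auto intro!: derivative_eq_intros dg dv simp: algebra_simps)
    moreover have "(x - y) * v' y \<noteq> 0" using \<open>x \<noteq> y\<close> y by (simp add: D_def)
    moreover have "h (v z) - (z * v z - g z) = 0" if "z \<in> D" for z
    proof -
      from that obtain t where t: "t \<in> ?J" "v z = u t" "z * v z - g z = t * u t - f t"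
        unfolding D_def Y_def by blast
      show ?thesis unfolding t(3) unfolding t(2) h_def X[OF t(1)] by simp
    qed
    ultimately show "y isolated_in D"
      using y by (intro isolated_in_nonzero_derivative)
  qed
  then have "countable (v ` D)"
    by (intro countable_image discrete_imp_countable)
  then have "negligible (v ` D)"
    by (simp add: negligible_iff_null_sets countable_imp_null_set_lborel null_sets_completionI)
  moreover have "u ` ?J \<subseteq> v ` C \<union> v ` D"
  proof
    fix m assume "m \<in> u ` ?J"
    then obtain x where "x \<in> ?J" "m = u x" by blast
    moreover obtain y where y: "y \<in> I" "v y = u x" "y * v y - g y = x * u x - f x"
      using cover[of x] \<open>x \<in> ?J\<close> unfolding greaterThanLessThan_iff by blast
    ultimately have "y \<in> Y" unfolding Y_def by blast
    then have "y \<in> C \<union> D" unfolding C_def D_def by blast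
    then show "m \<in> v ` C \<union> v ` D" using \<open>m = u x\<close> y(2) by (metis image_Un imageI)
  qed
  ultimately have "negligible (u ` ?J)"
    using negligible_Un negligible_subset by metis
  then show False
    using open_not_negligible[OF \<open>open (u ` ?J)\<close>] ab by auto
qed

section \<open>Agreement wherever a second derivative is non-zero\<close>

text \<open>Here \<open>x\<close> may be an endpoint of \<open>I\<close>, so the open interval found need not contain \<open>x\<close>.\<close>
lemma interval_inside_neighbourhood:
  fixes I :: "real set"
  assumes "convex I" "interior I \<noteq> {}" "x \<in> I" and P: "eventually P (at x within I)"
  shows "\<exists>a b. a < b \<and> {a<..<b} \<subseteq> I \<and> (\<forall>z\<in>{a<..<b}. P z)"
proof -
  obtain T where T: "open T" "x \<in> T" "\<And>z. z \<in> T \<Longrightarrow> z \<noteq> x \<Longrightarrow> z \<in> I \<Longrightarrow> P z"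
    using P unfolding eventually_at_topological by metis
  have "x \<in> closure (interior I)"
    using convex_closure_interior[OF assms(1,2)] assms(3) closure_subset by blast
  with T(1,2) have "T \<inter> interior I \<noteq> {}"
    using closure_iff_nhds_not_empty by blast
  moreover have "open (T \<inter> interior I)" using T(1) by auto
  ultimately have "\<not> T \<inter> interior I \<subseteq> {x}"
    using negligible_subset[OF negligible_sing] open_not_negligible by blast
  then obtain z where z: "z \<in> T \<inter> interior I - {x}" by blast
  moreover have "open (T \<inter> interior I - {x})" using T(1) by auto
  ultimately obtain e where e: "e > 0" "ball z e \<subseteq> T \<inter> interior I - {x}"
    using open_contains_ball by blast
  have "ball z e = {z - e<..<z + e}" by (rule ball_eq_greaterThanLessThan)
  with e T(3) interior_subset[of I] show ?thesis
    by (intro exI[of _ "z - e"] exI[of _ "z + e"]) auto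
qed

lemma same_tangent_where_curved:
  fixes f g u u' v v' :: "real \<Rightarrow> real"
  assumes I: "convex I" "interior I \<noteq> {}"
    and f: "\<And>x. x \<in> I \<Longrightarrow> (f has_real_derivative u x) (at x within I)"
    and u: "\<And>x. x \<in> I \<Longrightarrow> (u has_real_derivative u' x) (at x within I)"
    and u': "continuous_on I u'"
    and g: "\<And>x. x \<in> I \<Longrightarrow> (g has_real_derivative v x) (at x within I)"
    and v: "\<And>x. x \<in> I \<Longrightarrow> (v has_real_derivative v' x) (at x within I)"
    and cover: "\<And>x. x \<in> I \<Longrightarrow> \<exists>y\<in>I. v y = u x \<and> y * v y - g y = x * u x - f x"
    and x: "x \<in> I" "u' x \<noteq> 0"
  shows "f x = g x \<and> u x = v x"
proof (rule ccontr)
  assume neg: "\<not> ?thesis"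
  \<comment> \<open>Failure of the claim at \<open>x\<close> persists nearby, hence on an open interval where \<open>u' \<noteq> 0\<close>.\<close>
  have cont: "((\<lambda>z. (f z - g z)\<^sup>2 + (u z - v z)\<^sup>2) \<longlongrightarrow> (f x - g x)\<^sup>2 + (u x - v x)\<^sup>2) (at x within I)"
    using DERIV_continuous[OF f[OF x(1)]] DERIV_continuous[OF g[OF x(1)]]
      DERIV_continuous[OF u[OF x(1)]] DERIV_continuous[OF v[OF x(1)]]
    by (auto simp: continuous_within intro!: tendsto_intros)
  have "(f x - g x)\<^sup>2 + (u x - v x)\<^sup>2 \<noteq> 0" using neg by simp
  from tendsto_imp_eventually_ne[OF cont this]
  have "eventually (\<lambda>z. \<not> (f z = g z \<and> u z = v z)) (at x within I)"
    by eventually_elim simp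
  moreover have "eventually (\<lambda>z. u' z \<noteq> 0) (at x within I)"
    using u' x by (auto simp: continuous_on_def intro: tendsto_imp_eventually_ne)
  ultimately have "eventually (\<lambda>z. \<not> (f z = g z \<and> u z = v z) \<and> u' z \<noteq> 0) (at x within I)"
    by (rule eventually_conj)
  from interval_inside_neighbourhood[OF I x(1) this]
  obtain a b where ab: "a < b" "{a<..<b} \<subseteq> I"
    and ne: "\<And>z. z \<in> {a<..<b} \<Longrightarrow> \<not> (f z = g z \<and> u z = v z) \<and> u' z \<noteq> 0" by metis
  have at: "at z within I = at z" if "z \<in> {a<..<b}" for z
    using ab that by (meson at_within_interior interiorI open_greaterThanLessThan)
  have "\<exists>x. a < x \<and> x < b \<and> f x = g x \<and> u x = v x"
  proof (rule common_tangent_at_same_abscissa[OF ab(1) _ _ _ g v])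
    fix z assume "a < z" "z < b"
    then have z: "z \<in> {a<..<b}" "z \<in> I" using ab by auto
    show "(f has_real_derivative u z) (at z)" "(u has_real_derivative u' z) (at z)" "u' z \<noteq> 0"
      using f[OF z(2)] u[OF z(2)] at[OF z(1)] ne[OF z(1)] by auto
    show "\<exists>y\<in>I. v y = u z \<and> y * v y - g y = z * u z - f z" by (rule cover[OF z(2)])
  qed
  then show False using ne by auto
qed

lemma at_within_interval_nontrivial:
  fixes I :: "real set"
  assumes "convex I" "interior I \<noteq> {}" "x \<in> I"
  shows "at x within I \<noteq> bot"
proof
  assume "at x within I = bot"
  then have "eventually (\<lambda>_. False) (at x within I)" by simp
  from interval_inside_neighbourhood[OF assms this] show False
    by (metis dense greaterThanLessThan_iff)
qed

section \<open>Recovering a function from its tangent lines\<close>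

lemma tangent_lines_eq:
  assumes "convex I" "interior I \<noteq> {}"
    and f: "\<And>x. x \<in> I \<Longrightarrow> (f has_real_derivative u x) (at x within I)"
  shows "tangent_lines I f = {affine_line (u x) (x * u x - f x) | x. x \<in> I}"
proof -
  have "(f has_real_derivative m) (at x within I) \<longleftrightarrow> m = u x" if "x \<in> I" for x m
    using has_field_derivative_unique[OF _ f[OF that] at_within_interval_nontrivial[OF assms(1,2) that]]
      f[OF that] by blast
  then show ?thesis unfolding tangent_lines_def by (metis (no_types, lifting))
qed

lemma tangent_lines_eq_imp_eq:
  fixes f g :: "real \<Rightarrow> real"
  assumes I: "convex I" "interior I \<noteq> {}"
    and C2: "C2_on I f" "C2_on I g"
    and eq: "tangent_lines I f = tangent_lines I g"
    and x: "x \<in> I"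
  shows "f x = g x"
proof -
  obtain u u' where f: "\<And>x. x \<in> I \<Longrightarrow> (f has_real_derivative u x) (at x within I)"
    and u: "\<And>x. x \<in> I \<Longrightarrow> (u has_real_derivative u' x) (at x within I)"
    and u': "continuous_on I u'"
    using C2(1) unfolding C2_on_def by metis
  obtain v v' where g: "\<And>x. x \<in> I \<Longrightarrow> (g has_real_derivative v x) (at x within I)"
    and v: "\<And>x. x \<in> I \<Longrightarrow> (v has_real_derivative v' x) (at x within I)"
    and v': "continuous_on I v'"
    using C2(2) unfolding C2_on_def by metis
  have lines: "{affine_line (u x) (x * u x - f x) | x. x \<in> I}
      = {affine_line (v x) (x * v x - g x) | x. x \<in> I}"
    using eq tangent_lines_eq[OF I f] tangent_lines_eq[OF I g] by simp
  have fg: "\<exists>y\<in>I. v y = u x \<and> y * v y - g y = x * u x - f x" if "x \<in> I" for x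
  proof -
    have "affine_line (u x) (x * u x - f x) \<in> {affine_line (v x) (x * v x - g x) | x. x \<in> I}"
      using that lines by blast
    then show ?thesis by (auto simp: affine_line_eq_iff)
  qed
  have gf: "\<exists>y\<in>I. u y = v x \<and> y * u y - f y = x * v x - g x" if "x \<in> I" for x
  proof -
    have "affine_line (v x) (x * v x - g x) \<in> {affine_line (u x) (x * u x - f x) | x. x \<in> I}"
      using that lines by blast
    then show ?thesis by (auto simp: affine_line_eq_iff)
  qed
  have curved: "f z = g z \<and> u z = v z" if "z \<in> I" "u' z \<noteq> 0 \<or> v' z \<noteq> 0" for z
    using same_tangent_where_curved[OF I f u u' g v fg that(1)]
      same_tangent_where_curved[OF I g v v' f u gf that(1)] that(2) by auto
  have second_eq: "u' z = v' z" if z: "z \<in> I" for z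
  proof (rule ccontr)
    assume ne: "u' z \<noteq> v' z"
    \<comment> \<open>Near \<open>z\<close> one of \<open>u'\<close>, \<open>v'\<close> is non-zero, so \<open>u = v\<close> there and the derivatives agree at \<open>z\<close>.\<close>
    have "((\<lambda>t. u' t - v' t) \<longlongrightarrow> u' z - v' z) (at z within I)"
      using u' v' z by (auto simp: continuous_on_def intro!: tendsto_intros)
    then have "eventually (\<lambda>t. u' t - v' t \<noteq> 0) (at z within I)"
      using ne by (intro tendsto_imp_eventually_ne) auto
    moreover have "eventually (\<lambda>t. t \<in> I) (at z within I)"
      by (simp add: eventually_at_filter)
    ultimately have "eventually (\<lambda>t. u t = v t) (at z within I)"
      by eventually_elim (use curved in auto)
    moreover have "u z = v z" using curved[OF z] ne by auto
    ultimately have "(u has_real_derivative v' z) (at z within I)"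
      using v[OF z] has_field_derivative_cong_eventually by blast
    then show False
      using has_field_derivative_unique[OF u[OF z] _ at_within_interval_nontrivial[OF I z]] ne by blast
  qed
  have "\<exists>c. \<forall>t\<in>I. u t - v t = c"
    by (rule has_field_derivative_zero_constant[OF I(1)])
       (auto intro!: derivative_eq_intros u v simp: second_eq)
  then obtain c where c: "\<And>t. t \<in> I \<Longrightarrow> u t - v t = c" by blast
  show "f x = g x"
  proof (cases "\<exists>z\<in>I. u' z \<noteq> 0")
    case True
    then obtain z where z: "z \<in> I" "f z = g z" "u z = v z" using curved by blast
    then have uv: "u t = v t" if "t \<in> I" for t using c[OF that] c[OF z(1)] by simp
    have "\<exists>d. \<forall>t\<in>I. f t - g t = d"
      by (rule has_field_derivative_zero_constant[OF I(1)])
         (auto intro!: derivative_eq_intros f g simp: uv)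
    then show ?thesis using z x by (metis eq_iff_diff_eq_0)
  next
    case False
    have "\<exists>m. \<forall>t\<in>I. v t = m"
      by (rule has_field_derivative_zero_constant[OF I(1)]) (use v second_eq False in force)
    then obtain m where m: "\<And>t. t \<in> I \<Longrightarrow> v t = m" by blast
    have "\<exists>d. \<forall>t\<in>I. t * m - g t = d"
      by (rule has_field_derivative_zero_constant[OF I(1)])
         (auto intro!: derivative_eq_intros g simp: m)
    then obtain d where d: "\<And>t. t \<in> I \<Longrightarrow> t * m - g t = d" by blast
    from fg[OF x] obtain y where "y \<in> I" "v y = u x" "y * v y - g y = x * u x - f x" by blast
    then have "x * m - f x = y * m - g y" using m by auto
    then show ?thesis using d[OF x] d[OF \<open>y \<in> I\<close>] by simp
  qed
qed

theorem theoremA1: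
  fixes I :: "real set" and f1 f2 :: "real \<Rightarrow> real"
  assumes "is_interval I" and "interior I \<noteq> {}"
    and "C2_on I f1" and "C2_on I f2"
  shows "tangent_lines I f1 = tangent_lines I f2 \<longleftrightarrow> (\<forall>x\<in>I. f1 x = f2 x)"
proof
  assume "tangent_lines I f1 = tangent_lines I f2"
  with assms show "\<forall>x\<in>I. f1 x = f2 x"
    using tangent_lines_eq_imp_eq is_interval_convex by blast
next
  assume eq: "\<forall>x\<in>I. f1 x = f2 x"
  have "(f1 has_real_derivative m) (at x within I) \<longleftrightarrow> (f2 has_real_derivative m) (at x within I)"
    if "x \<in> I" for x m
    using eq that by (intro has_field_derivative_cong_eventually) (auto simp: eventually_at_filter)
  with eq show "tangent_lines I f1 = tangent_lines I f2"
    unfolding tangent_lines_def by (metis (no_types, lifting))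
qed

end
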